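(* Let $(X,N_1,\phi,K,*_1)$ and $(Y,N_2,\phi,K,*_2)$ be fuzzy strong $\phi$-b-normed linear spaces and let $T:X\to Y$ be a linear operator. If $T$ is fuzzy bounded, then $T$ is fuzzy continuous (at every point of $X$). The converse does not hold in general: there exist fuzzy strong $\phi$-b-normed linear spaces $(X,N_1,\phi,K,*_1)$ and $(Y,N_2,\phi,K,*_2)$ and a linear operator $T:X\to Y$ which is fuzzy continuous but not fuzzy bounded.
   Context: A t-norm is a binary operation $*:[0,1]\times[0,1]\to[0,1]$ that is associative, commutative, satisfies $\alpha*1=\alpha$ for all $\alpha\in[0,1]$, and $\alpha*\gamma\le\beta*\delta$ whenever $\alpha\le\beta$, $\gamma\le\delta$. $\phi:\mathbb{R}\to\mathbb{R}$ denotes a function such that $\phi(-t)=\phi(t)$ for all $t$; $\phi(1)=1$; $\phi$ is strictly increasing and continuous on $(0,\infty)$; $\lim_{\alpha\to0}\phi(\alpha)=0$ and $\lim_{\alpha\to\infty}\phi(\alpha)=\infty$. Let $X$ be a real linear space with zero vector $\theta$, $K\ge1$ a real number and $*$ a t-norm. A function $N:X\times\mathbb{R}\to[0,1]$ is a fuzzy strong $\phi$-b-norm on $X$, and $(X,N,\phi,K,* )$ is a fuzzy strong $\phi$-b-normed linear space, if for all $x,y\in X$: (bN1) $N(x,t)=0$ for all $t\le0$; (bN2) $N(x,t)=1$ for all $t>0$ if and only if $x=\theta$; (bN3) $N(cx,t)=N(x,t/\phi(c))$ for all $t>0$ and all $c\in\mathbb{R}$ with $\phi(c)\ne0$; (bN4)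 $N(x+y,s+Kt)\ge N(x,s)*N(y,t)$ for all $s,t\in\mathbb{R}$; (bN5) $N(x,\cdot)$ is non-decreasing and $\lim_{t\to\infty}N(x,t)=1$. A linear operator $T:X\to Y$ is fuzzy bounded if for each $\alpha\in(0,1)$ there is $M_\alpha>0$ such that for all $x\in X$ and all $t>0$: $N_1(x,t/M_\alpha)\ge1-\alpha$ implies $N_2(Tx,Ks)\ge\alpha$ for all $s>t$. $T$ is fuzzy continuous at $x\in X$ if for every sequence $\{x_n\}$ in $X$, $\lim_{n\to\infty}N_1(x_n-x,t)=1$ for all $t>0$ implies $\lim_{n\to\infty}N_2(Tx_n-Tx,t)=1$ for all $t>0$. $T$ is fuzzy continuous if it is fuzzy continuous at every $x\in X$. *)

theory Defs
  imports Complex_Main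
begin

text \<open>
  Functions into the unit interval are real-valued functions with explicit bounds; a t-norm is
  constrained only on the unit square, its values elsewhere being irrelevant.
\<close>

definition t_norm :: "(real \<Rightarrow> real \<Rightarrow> real) \<Rightarrow> bool" where
  "t_norm tn \<longleftrightarrow>
     (\<forall>a\<in>{0..1}. \<forall>b\<in>{0..1}. tn a b \<in> {0..1}) \<and>
     (\<forall>a\<in>{0..1}. \<forall>b\<in>{0..1}. \<forall>c\<in>{0..1}. tn (tn a b) c = tn a (tn b c)) \<and>
     (\<forall>a\<in>{0..1}. \<forall>b\<in>{0..1}. tn a b = tn b a) \<and>
     (\<forall>a\<in>{0..1}. tn a 1 = a) \<and>
     (\<forall>a\<in>{0..1}. \<forall>b\<in>{0..1}. \<forall>c\<in>{0..1}. \<forall>d\<in>{0..1}.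
        a \<le> b \<longrightarrow> c \<le> d \<longrightarrow> tn a c \<le> tn b d)"

text \<open>The value of \<open>\<phi>\<close> at \<open>0\<close> is deliberately left unconstrained.\<close>

definition phi_function :: "(real \<Rightarrow> real) \<Rightarrow> bool" where
  "phi_function \<phi> \<longleftrightarrow>
     (\<forall>t. \<phi> (- t) = \<phi> t) \<and>
     \<phi> 1 = 1 \<and>
     strict_mono_on {0<..} \<phi> \<and>
     continuous_on {0<..} \<phi> \<and>
     (\<phi> \<longlongrightarrow> 0) (at 0) \<and>
     filterlim \<phi> at_top at_top"

definition fuzzy_strong_phi_b_normed_space ::
  "('a::real_vector \<Rightarrow> real \<Rightarrow> real) \<Rightarrow> (real \<Rightarrow> real) \<Rightarrow> real \<Rightarrow> (real \<Rightarrow> real \<Rightarrow> real) \<Rightarrow> bool" where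
  "fuzzy_strong_phi_b_normed_space N \<phi> K tn \<longleftrightarrow>
     phi_function \<phi> \<and> K \<ge> 1 \<and> t_norm tn \<and>
     (\<forall>x t. N x t \<in> {0..1}) \<and>
     (\<forall>x t. t \<le> 0 \<longrightarrow> N x t = 0) \<and>
     (\<forall>x. (\<forall>t>0. N x t = 1) \<longleftrightarrow> x = 0) \<and>
     (\<forall>x c t. t > 0 \<longrightarrow> \<phi> c \<noteq> 0 \<longrightarrow> N (c *\<^sub>R x) t = N x (t / \<phi> c)) \<and>
     (\<forall>x y s t. N (x + y) (s + K * t) \<ge> tn (N x s) (N y t)) \<and>
     (\<forall>x. mono (N x) \<and> (N x \<longlongrightarrow> 1) at_top)"

definition fuzzy_bounded ::
  "real \<Rightarrow> ('a::real_vector \<Rightarrow> real \<Rightarrow> real) \<Rightarrow> ('b::real_vector \<Rightarrow> real \<Rightarrow> real) \<Rightarrow> ('a \<Rightarrow> 'b) \<Rightarrow> bool" where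
  "fuzzy_bounded K N1 N2 T \<longleftrightarrow>
     (\<forall>\<alpha>\<in>{0<..<1}. \<exists>M>0. \<forall>x. \<forall>t>0.
        N1 x (t / M) \<ge> 1 - \<alpha> \<longrightarrow> (\<forall>s>t. N2 (T x) (K * s) \<ge> \<alpha>))"

definition fuzzy_continuous_at ::
  "('a::real_vector \<Rightarrow> real \<Rightarrow> real) \<Rightarrow> ('b::real_vector \<Rightarrow> real \<Rightarrow> real) \<Rightarrow> ('a \<Rightarrow> 'b) \<Rightarrow> 'a \<Rightarrow> bool" where
  "fuzzy_continuous_at N1 N2 T x \<longleftrightarrow>
     (\<forall>X :: nat \<Rightarrow> 'a.
        (\<forall>t>0. (\<lambda>n. N1 (X n - x) t) \<longlonglongrightarrow> 1) \<longrightarrow>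
        (\<forall>t>0. (\<lambda>n. N2 (T (X n) - T x) t) \<longlonglongrightarrow> 1))"

definition fuzzy_continuous ::
  "('a::real_vector \<Rightarrow> real \<Rightarrow> real) \<Rightarrow> ('b::real_vector \<Rightarrow> real \<Rightarrow> real) \<Rightarrow> ('a \<Rightarrow> 'b) \<Rightarrow> bool" where
  "fuzzy_continuous N1 N2 T \<longleftrightarrow> (\<forall>x. fuzzy_continuous_at N1 N2 T x)"

end

theory Submission
  imports Defs
begin

text \<open>
  If \<open>x\<^sub>n\<close> tends to \<open>x\<close>, then \<open>N1 (x\<^sub>n - x)\<close> eventually exceeds the threshold \<open>1 - \<alpha>\<close>, so
  boundedness forces \<open>N2 (T x\<^sub>n - T x) \<ge> \<alpha>\<close> eventually, for every \<open>\<alpha> < 1\<close>.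

  For the counterexample, consider on the real line the fuzzy norms that are \<open>1\<close> for \<open>t > \<bar>x\<bar>\<close> and
  take a constant value \<open>h < 1\<close> for \<open>0 < t \<le> \<bar>x\<bar>\<close>. All of them have the usual convergent
  sequences, so the identity is continuous between any two. From \<open>h = 1/2\<close> to \<open>h = 0\<close> it is not
  bounded: for \<open>\<alpha> = 1/2\<close> the premise of boundedness always holds, but its conclusion does not.
\<close>

lemma fuzzy_bounded_imp_fuzzy_continuous:
  assumes N2: "fuzzy_strong_phi_b_normed_space N2 \<phi> K tn"
    and T: "linear T" and bounded: "fuzzy_bounded K N1 N2 T"
  shows "fuzzy_continuous N1 N2 T"
  unfolding fuzzy_continuous_def fuzzy_continuous_at_def
proof (intro allI impI)
  fix x X and t :: real
  assume lim: "\<forall>t>0. (\<lambda>n. N1 (X n - x) t) \<longlonglongrightarrow> 1" and t: "t > 0"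
  have K: "K \<ge> 1" and N2_le: "\<And>x t. N2 x t \<le> 1"
    using N2 unfolding fuzzy_strong_phi_b_normed_space_def by auto
  show "(\<lambda>n. N2 (T (X n) - T x) t) \<longlonglongrightarrow> 1"
  proof (rule order_tendstoI)
    fix a :: real assume "a < 1"
    \<comment> \<open>The bound \<open>a\<close> may be negative, while boundedness speaks only of
      levels in (0,1); hence the maximum with 0.\<close>
    then obtain \<alpha> where \<alpha>: "max 0 a < \<alpha>" "\<alpha> < 1"
      using dense[of "max 0 a" 1] by auto
    then obtain M where M: "M > 0" and
      MN: "\<And>x t s. t > 0 \<Longrightarrow> N1 x (t / M) \<ge> 1 - \<alpha> \<Longrightarrow> s > t \<Longrightarrow> N2 (T x) (K * s) \<ge> \<alpha>"
      using bounded unfolding fuzzy_bounded_def by force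
    \<comment> \<open>Boundedness needs s strictly above its premise level. Taking s = t / K makes K
      * s equal to t, and \<open>r\<close> is a positive number below that s.\<close>
    define r where "r = t / (2 * K)"
    have r: "r > 0" "r < t / K"
      using t K by (auto simp: r_def field_simps)
    have "(\<lambda>n. N1 (X n - x) (r / M)) \<longlonglongrightarrow> 1"
      using lim r M by simp
    then have "\<forall>\<^sub>F n in sequentially. N1 (X n - x) (r / M) > 1 - \<alpha>"
      by (rule order_tendstoD) (use \<alpha> in auto)
    then show "\<forall>\<^sub>F n in sequentially. N2 (T (X n) - T x) t > a"
    proof eventually_elim
      case (elim n)
      then have "N2 (T (X n - x)) (K * (t / K)) \<ge> \<alpha>"
        using MN[of r "X n - x" "t / K"] r by simp
      then show ?case
        using K \<alpha> linear_diff[OF T] by simp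
    qed
  next
    fix a :: real assume "1 < a"
    then show "\<forall>\<^sub>F n in sequentially. N2 (T (X n) - T x) t < a"
      using N2_le by (meson always_eventually order_le_less_trans)
  qed
qed

definition step_norm :: "real \<Rightarrow> real \<Rightarrow> real \<Rightarrow> real" where
  "step_norm h x t = (if \<bar>x\<bar> < t then 1 else if 0 < t then h else 0)"

lemma t_norm_min: "t_norm min"
  unfolding t_norm_def by (auto simp: min_def)

text \<open>With this choice the scaling axiom becomes the usual N(cx, t) = N(x, t / |c|), which
  suits norms built from the absolute value.\<close>

lemma phi_function_abs: "phi_function abs"
proof -
  have "((\<lambda>t::real. \<bar>t\<bar>) \<longlongrightarrow> 0) (at 0)"
    by (auto intro!: tendsto_eq_intros)
  moreover have "filterlim (abs :: real \<Rightarrow> real) at_top at_top"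
    by (rule filterlim_at_top_mono[OF filterlim_ident]) (intro always_eventually allI abs_ge_self)
  moreover have "continuous_on {0<..} (abs :: real \<Rightarrow> real)"
    by (intro continuous_intros)
  ultimately show ?thesis
    unfolding phi_function_def by (auto simp: strict_mono_on_def)
qed

text \<open>If both values in the triangle axiom are 1, it reduces to the triangle inequality for
  the absolute value. Otherwise the minimum is at most \<open>h\<close>, and it is positive only
  when s and t are, in which case s + t > 0 and the right side is at least \<open>h\<close>.\<close>

lemma step_norm_space:
  assumes h: "0 \<le> h" "h < 1"
  shows "fuzzy_strong_phi_b_normed_space (step_norm h) abs 1 min"
proof -
  have range: "step_norm h x t \<in> {0..1}" for x t
    using h by (simp add: step_norm_def)
  \<comment> \<open>For nonzero x, the level t = |x| is positive and has value \<open>h\<close> <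
    1.\<close>
  have zero: "(\<forall>t>0. step_norm h x t = 1) \<longleftrightarrow> x = 0" for x
    using h by (auto simp: step_norm_def dest: spec[of _ "\<bar>x\<bar>"])
  have scale: "step_norm h (c * x) t = step_norm h x (t / \<bar>c\<bar>)" if "t > 0" "c \<noteq> 0" for c x t
    using that by (simp add: step_norm_def abs_mult field_simps)
  have add: "min (step_norm h x s) (step_norm h y t) \<le> step_norm h (x + y) (s + t)" for x y s t
    using h by (auto simp: step_norm_def)
  have mono: "mono (step_norm h x)" for x
    using h by (auto simp: mono_def step_norm_def)
  have lim: "(step_norm h x \<longlongrightarrow> 1) at_top" for x
    by (rule tendsto_eventually, rule eventually_mono[OF eventually_gt_at_top[of "\<bar>x\<bar>"]])
      (simp add: step_norm_def)
  show ?thesis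
    unfolding fuzzy_strong_phi_b_normed_space_def
    using phi_function_abs t_norm_min range zero scale add mono lim
    by (auto simp: step_norm_def[of h _ t for t])
qed

text \<open>At a fixed t > 0 only the values 1 and \<open>h\<close> occur, so convergence to 1 means
  being eventually equal to 1, that is, |X n| < t eventually.\<close>

lemma step_norm_tendsto_1_iff:
  assumes "h < 1"
  shows "(\<forall>t>0. (\<lambda>n. step_norm h (X n) t) \<longlonglongrightarrow> 1) \<longleftrightarrow> X \<longlonglongrightarrow> 0"
proof
  assume lim: "\<forall>t>0. (\<lambda>n. step_norm h (X n) t) \<longlonglongrightarrow> 1"
  show "X \<longlonglongrightarrow> 0"
  proof (rule tendstoI)
    fix e :: real assume e: "e > 0"
    then have "(\<lambda>n. step_norm h (X n) e) \<longlonglongrightarrow> 1"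
      using lim by simp
    then have "\<forall>\<^sub>F n in sequentially. step_norm h (X n) e > h"
      using assms by (rule order_tendstoD)
    then show "\<forall>\<^sub>F n in sequentially. dist (X n) 0 < e"
      by eventually_elim (use e in \<open>auto simp: step_norm_def split: if_splits\<close>)
  qed
next
  assume lim: "X \<longlonglongrightarrow> 0"
  show "\<forall>t>0. (\<lambda>n. step_norm h (X n) t) \<longlonglongrightarrow> 1"
  proof (intro allI impI tendsto_eventually)
    fix t :: real assume "t > 0"
    with lim have "\<forall>\<^sub>F n in sequentially. dist (X n) 0 < t"
      by (rule tendstoD)
    then show "\<forall>\<^sub>F n in sequentially. step_norm h (X n) t = 1"
      by eventually_elim (simp add: step_norm_def)
  qed
qed

lemma fuzzy_continuous_step_norm_id:
  assumes "h < 1" "h' < 1"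
  shows "fuzzy_continuous (step_norm h) (step_norm h') (\<lambda>x. x)"
  unfolding fuzzy_continuous_def fuzzy_continuous_at_def
  using assms by (simp add: step_norm_tendsto_1_iff)

lemma not_fuzzy_bounded_step_norm_id:
  "\<not> fuzzy_bounded 1 (step_norm (1/2)) (step_norm 0) (\<lambda>x. x)"
proof
  assume "fuzzy_bounded 1 (step_norm (1/2)) (step_norm 0) (\<lambda>x. x)"
  moreover have "(1/2 :: real) \<in> {0<..<1}"
    by simp
  ultimately obtain M where "M > 0" and M: "\<And>x t s. t > 0 \<Longrightarrow>
      step_norm (1/2) x (t / M) \<ge> 1 - 1/2 \<Longrightarrow> s > t \<Longrightarrow> step_norm 0 x (1 * s) \<ge> 1/2"
    unfolding fuzzy_bounded_def by meson
  \<comment> \<open>At x = 1 the norm with \<open>h\<close> = 0 still vanishes at s = 1, the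
    inequality |x| < s being strict. The premise holds at t = 1/2 for any \<open>M\<close> > 0,
    since the other norm is at least 1/2 at every positive level.\<close>
  have "step_norm 0 1 (1 * 1) \<ge> 1/2"
    by (rule M[of "1/2"]) (use \<open>M > 0\<close> in \<open>auto simp: step_norm_def\<close>)
  then show False
    by (simp add: step_norm_def)
qed

theorem theorem3p8:
  "(\<forall>(N1 :: 'a::real_vector \<Rightarrow> real \<Rightarrow> real) (N2 :: 'b::real_vector \<Rightarrow> real \<Rightarrow> real)
      (\<phi> :: real \<Rightarrow> real) (K :: real)
      (tn1 :: real \<Rightarrow> real \<Rightarrow> real) (tn2 :: real \<Rightarrow> real \<Rightarrow> real) (T :: 'a \<Rightarrow> 'b).
      fuzzy_strong_phi_b_normed_space N1 \<phi> K tn1 \<longrightarrow>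
      fuzzy_strong_phi_b_normed_space N2 \<phi> K tn2 \<longrightarrow>
      linear T \<longrightarrow> fuzzy_bounded K N1 N2 T \<longrightarrow> fuzzy_continuous N1 N2 T) \<and>
   (\<exists>(N1 :: real \<Rightarrow> real \<Rightarrow> real) (N2 :: real \<Rightarrow> real \<Rightarrow> real)
      (\<phi> :: real \<Rightarrow> real) (K :: real)
      (tn1 :: real \<Rightarrow> real \<Rightarrow> real) (tn2 :: real \<Rightarrow> real \<Rightarrow> real) (T :: real \<Rightarrow> real).
      fuzzy_strong_phi_b_normed_space N1 \<phi> K tn1 \<and>
      fuzzy_strong_phi_b_normed_space N2 \<phi> K tn2 \<and>
      linear T \<and> fuzzy_continuous N1 N2 T \<and> \<not> fuzzy_bounded K N1 N2 T)"
proof (rule conjI)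
  show "\<exists>(N1 :: real \<Rightarrow> real \<Rightarrow> real) N2 \<phi> K tn1 tn2 (T :: real \<Rightarrow> real).
      fuzzy_strong_phi_b_normed_space N1 \<phi> K tn1 \<and>
      fuzzy_strong_phi_b_normed_space N2 \<phi> K tn2 \<and>
      linear T \<and> fuzzy_continuous N1 N2 T \<and> \<not> fuzzy_bounded K N1 N2 T"
  proof (intro exI conjI)
    show "fuzzy_strong_phi_b_normed_space (step_norm (1/2)) abs 1 min"
      "fuzzy_strong_phi_b_normed_space (step_norm 0) abs 1 min"
      by (rule step_norm_space; simp)+
    show "linear (\<lambda>x::real. x)"
      by (rule linear_ident)
    show "fuzzy_continuous (step_norm (1/2)) (step_norm 0) (\<lambda>x. x)"
      by (rule fuzzy_continuous_step_norm_id; simp)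
    show "\<not> fuzzy_bounded 1 (step_norm (1/2)) (step_norm 0) (\<lambda>x. x)"
      by (rule not_fuzzy_bounded_step_norm_id)
  qed
qed (blast intro: fuzzy_bounded_imp_fuzzy_continuous)

end
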